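(* Let $p>1$ and $1\le\alpha\le1+1/p$. Then for every complex sequence $\mathbf a=(a_n)_{n\ge1}\in l^p$, $$\sum_{n=1}^{\infty}\left|\frac{1}{n^{\alpha}}\sum_{i=1}^n\alpha\Big(i-\frac12\Big)^{\alpha-1}a_i\right|^p\ \le\ \Big(\frac{\alpha p}{\alpha p-1}\Big)^p\sum_{n=1}^{\infty}|a_n|^p .$$
   Context: $l^p$ is the space of complex sequences with $\sum_n|a_n|^p<\infty$. *)

theory Defs
  imports "HOL-Analysis.Analysis"
begin

text \<open>Sequences are indexed by \<open>n \<ge> 1\<close>; the value at \<open>0\<close> plays no role.\<close>

definition in_lp :: "real \<Rightarrow> (nat \<Rightarrow> complex) \<Rightarrow> bool" where
  "in_lp p a \<longleftrightarrow> (\<lambda>n. cmod (a n) powr p) summable_on {1..}"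

definition midpoint_mean :: "real \<Rightarrow> (nat \<Rightarrow> complex) \<Rightarrow> nat \<Rightarrow> complex" where
  "midpoint_mean \<alpha> a n =
     complex_of_real (1 / real n powr \<alpha>) *
       (\<Sum>i=1..n. complex_of_real (\<alpha> * (real i - 1 / 2) powr (\<alpha> - 1)) * a i)"

end

theory Submission
  imports Defs
begin

text \<open>Put \<open>\<beta> = \<alpha> - 1/p\<close>. The hypothesis on \<open>\<alpha>\<close> says \<open>0 < \<beta> \<le> 1\<close>, so that \<open>x powr (\<beta> - 1)\<close> is
  convex and the midpoint rule underestimates its integral. Hoelder's inequality with the weights
  \<open>(i - 1/2) powr (\<beta> - 1)\<close>, which reflect the critical sequence \<open>i powr (-1/p)\<close>, bounds the
  \<open>n\<close>-th term by \<open>n powr (-\<beta> - 1)\<close> times a partial sum of \<open>(i - 1/2) powr \<beta> * \<bar>a\<^sub>i\<bar> powr p\<close>.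
  After interchanging the summations, the midpoint rule for \<open>x powr (-\<beta> - 1)\<close> bounds the
  tails, and all powers of \<open>i - 1/2\<close> cancel.\<close>

text \<open>Jensen's inequality for the convex function \<open>x powr p\<close>, with the weights
  normalised to total 1; this is the form of Hoelder used below.\<close>

lemma powr_sum_mult_le:
  fixes w y :: "'a \<Rightarrow> real"
  assumes "finite S" "p \<ge> 1" "\<And>i. i \<in> S \<Longrightarrow> w i > 0" "\<And>i. i \<in> S \<Longrightarrow> y i \<ge> 0"
  shows "(\<Sum>i\<in>S. w i * y i) powr p \<le> (\<Sum>i\<in>S. w i) powr (p - 1) * (\<Sum>i\<in>S. w i * y i powr p)"
proof -
  \<comment> \<open>The library has convexity of powers only on the open half-line.\<close>
  define T where "T = {i\<in>S. y i > 0}"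
  have T: "finite T" "T \<subseteq> S" using assms(1) by (auto simp: T_def)
  have y0: "y i = 0" if "i \<in> S - T" for i
    using that assms(4)[of i] by (auto simp: T_def)
  have *: "(\<Sum>i\<in>S. w i * y i) = (\<Sum>i\<in>T. w i * y i)"
    "(\<Sum>i\<in>S. w i * y i powr p) = (\<Sum>i\<in>T. w i * y i powr p)"
    using assms(1) T y0 by (auto intro!: sum.mono_neutral_right)
  show ?thesis
  proof (cases "T = {}")
    case True
    then show ?thesis unfolding * by simp
  next
    case False
    define W where "W = sum w T"
    have W: "W > 0" unfolding W_def
      using T False assms(3) by (intro sum_pos) auto
    have W_le: "W \<le> sum w S" unfolding W_def
      using T assms by (intro sum_mono2) (auto simp: less_imp_le)
    have "(\<Sum>i\<in>T. (w i / W) *\<^sub>R y i) powr p \<le> (\<Sum>i\<in>T. (w i / W) * y i powr p)"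
      using T False W assms(3)
      by (intro convex_on_sum[OF _ _ powr_convex[OF assms(2)]])
        (auto simp: T_def W_def less_imp_le simp flip: sum_divide_distrib)
    then have "((\<Sum>i\<in>T. w i * y i) / W) powr p \<le> (\<Sum>i\<in>T. w i * y i powr p) / W"
      by (simp add: sum_divide_distrib)
    moreover have "(\<Sum>i\<in>T. w i * y i) \<ge> 0"
      using T assms by (intro sum_nonneg) (auto simp: T_def less_imp_le)
    ultimately have "(\<Sum>i\<in>T. w i * y i) powr p \<le> W powr (p - 1) * (\<Sum>i\<in>T. w i * y i powr p)"
      using W by (simp add: powr_divide powr_diff field_simps)
    \<comment> \<open>Passing from \<open>T\<close> back to \<open>S\<close> only enlarges the total
      weight, and the exponent \<open>p - 1\<close> is nonnegative.\<close>
    also have "\<dots> \<le> sum w S powr (p - 1) * (\<Sum>i\<in>T. w i * y i powr p)"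
      using W W_le T assms
      by (intro mult_right_mono powr_mono2 sum_nonneg) (auto simp: T_def less_imp_le)
    finally show ?thesis unfolding * .
  qed
qed

text \<open>Since \<open>(m + t) * (m - t)\<close> is at most the square of \<open>m\<close>, the
  nonpositive exponent \<open>s / 2\<close> reverses the comparison; the inequality of arithmetic
  and geometric means does the rest.\<close>

lemma powr_midpoint_convex:
  fixes m t s :: real
  assumes "0 \<le> t" "t < m" "s \<le> 0"
  shows "2 * m powr s \<le> (m + t) powr s + (m - t) powr s"
proof -
  have sq: "(x powr (s / 2))\<^sup>2 = x powr s" for x :: real
    by (simp add: power2_eq_square flip: powr_add)
  have "m powr s = (m\<^sup>2) powr (s / 2)"
    using assms by (simp add: power2_eq_square powr_mult flip: powr_add)
  also have "\<dots> \<le> ((m + t) * (m - t)) powr (s / 2)"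
    using assms by (intro powr_mono2') (auto simp: power2_eq_square algebra_simps intro!: mult_strict_mono)
  also have "\<dots> = (m + t) powr (s / 2) * (m - t) powr (s / 2)"
    using assms by (simp add: powr_mult)
  finally have "2 * m powr s \<le> 2 * (m + t) powr (s / 2) * (m - t) powr (s / 2)" by simp
  also have "\<dots> \<le> ((m + t) powr (s / 2))\<^sup>2 + ((m - t) powr (s / 2))\<^sup>2"
    by (rule sum_squares_bound)
  also have "\<dots> = (m + t) powr s + (m - t) powr s"
    by (simp only: sq)
  finally show ?thesis .
qed

text \<open>The right-hand side is the integral of \<open>x powr (g - 1)\<close> over the interval
  from \<open>m - h\<close> to \<open>m + h\<close>. As a function of the half-width, the error
  \<open>F\<close> vanishes at 0 and has nonnegative derivative by midpoint convexity. The case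
  \<open>h = m\<close> admits an interval starting at the singularity 0.\<close>

lemma powr_midpoint_rule:
  fixes m h g :: real
  assumes "0 < h" "h < m \<or> h = m \<and> g > 0" "g \<noteq> 0" "g \<le> 1"
  shows "2 * h * m powr (g - 1) \<le> ((m + h) powr g - (m - h) powr g) / g"
proof -
  define F where "F t = ((m + t) powr g - (m - t) powr g) / g - 2 * t * m powr (g - 1)" for t
  have "F 0 \<le> F h"
  proof (rule DERIV_nonneg_imp_increasing_open[where f = F])
    fix t assume t: "0 < t" "t < h"
    have D: "((\<lambda>t. (m + t) powr g) has_real_derivative g * (m + t) powr (g - 1)) (at t)"
      "((\<lambda>t. (m - t) powr g) has_real_derivative - g * (m - t) powr (g - 1)) (at t)"
      using t assms DERIV_fun_powr[of "\<lambda>t. m + t" 1 t g] DERIV_fun_powr[of "\<lambda>t. m - t" "-1" t g]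
      by (auto intro!: derivative_eq_intros)
    have "(F has_real_derivative
        ((m + t) powr (g - 1) + (m - t) powr (g - 1) - 2 * m powr (g - 1))) (at t)"
      unfolding F_def using t assms
      by (auto intro!: derivative_eq_intros D simp: diff_divide_distrib)
    moreover have "2 * m powr (g - 1) \<le> (m + t) powr (g - 1) + (m - t) powr (g - 1)"
      using t assms by (intro powr_midpoint_convex) auto
    ultimately show "\<exists>y. (F has_real_derivative y) (at t) \<and> 0 \<le> y" by force
  next
    \<comment> \<open>If \<open>h = m\<close>, the base \<open>m - t\<close> reaches 0 at the
      endpoint; there \<open>g > 0\<close> keeps the power continuous.\<close>
    show "continuous_on {0..h} F"
      unfolding F_def using assms
      by (intro continuous_intros continuous_on_powr') auto
  qed (use assms in auto)
  then show ?thesis by (simp add: F_def)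
qed

text \<open>The points \<open>i - 1/2\<close> are the midpoints of the cells from
  \<open>i - 1\<close> to \<open>i\<close>, whose integrals telescope over the range from 0 to
  \<open>n\<close>. The cell \<open>i = 1\<close> touches 0 and is the case \<open>h = m\<close> of
  the midpoint rule.\<close>

lemma sum_midpoint_powr_le:
  fixes b :: real
  assumes "0 < b" "b \<le> 1"
  shows "(\<Sum>i=1..n. (real i - 1/2) powr (b - 1)) \<le> real n powr b / b"
proof -
  have "(\<Sum>i=1..n. (real i - 1/2) powr (b - 1))
      \<le> (\<Sum>i=1..n. real i powr b / b - real (i - 1) powr b / b)"
  proof (rule sum_mono)
    fix i assume "i \<in> {1..n}"
    then show "(real i - 1/2) powr (b - 1) \<le> real i powr b / b - real (i - 1) powr b / b"
      using powr_midpoint_rule[of "1/2" "real i - 1/2" b] assms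
      by (cases "i = Suc 0") (auto simp: diff_divide_distrib of_nat_diff)
  qed
  also have "\<dots> = real n powr b / b"
    using sum_telescope''[of 0 n "\<lambda>i. real i powr b / b"] by simp
  finally show ?thesis .
qed

lemma sum_powr_le_midpoint:
  fixes b :: real
  assumes "0 < b" "1 \<le> k" "k \<le> N"
  shows "(\<Sum>n=k..N. real n powr (- b - 1)) \<le> (real k - 1/2) powr (- b) / b"
proof -
  \<comment> \<open>An antiderivative of \<open>x powr (- b - 1)\<close>, taken at
    \<open>n - 1/2\<close>: the cells are shifted by a half so that the integers become
    midpoints.\<close>
  define f where "f n = - ((real n - 1/2) powr (- b) / b)" for n
  have "(\<Sum>n=k..N. real n powr (- b - 1)) \<le> (\<Sum>n=k..N. f (Suc n) - f n)"
  proof (rule sum_mono)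
    fix n assume "n \<in> {k..N}"
    then show "real n powr (- b - 1) \<le> f (Suc n) - f n"
      using powr_midpoint_rule[of "1/2" "real n" "- b"] assms
      by (auto simp: f_def diff_divide_distrib algebra_simps)
  qed
  also have "\<dots> = f (Suc N) - f k"
    using assms by (intro sum_Suc_diff) auto
  also have "\<dots> \<le> (real k - 1/2) powr (- b) / b"
    using assms by (simp add: f_def)
  finally show ?thesis .
qed

lemma cmod_midpoint_mean_powr_le:
  fixes p \<alpha> b :: real and a :: "nat \<Rightarrow> complex"
  assumes "p > 1" "1 \<le> \<alpha>" "b \<le> 1" "0 < b" and b: "b = \<alpha> - 1 / p" and "n \<ge> 1"
  shows "cmod (midpoint_mean \<alpha> a n) powr p \<le> \<alpha> powr p / b powr (p - 1) *
    (real n powr (- b - 1) * (\<Sum>i=1..n. (real i - 1/2) powr b * cmod (a i) powr p))"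
proof -
  \<comment> \<open>As \<open>\<alpha> - 1 = (b - 1) + 1 / p\<close>, the kernel times
    \<open>cmod (a i)\<close> is \<open>\<alpha> * w i * y i\<close>; the exponent
    \<open>1 / p\<close> in \<open>y\<close> turns the weight into \<open>(i - 1/2) powr b\<close>
    after taking \<open>p\<close>-th powers.\<close>
  define w where "w i = (real i - 1/2) powr (b - 1)" for i :: nat
  define y where "y i = (real i - 1/2) powr (1 / p) * cmod (a i)" for i :: nat
  define S where "S = (\<Sum>i=1..n. (real i - 1/2) powr b * cmod (a i) powr p)"
  have S: "S \<ge> 0" unfolding S_def by (intro sum_nonneg) auto
  have "cmod (midpoint_mean \<alpha> a n) \<le>
      1 / real n powr \<alpha> * (\<Sum>i=1..n. \<alpha> * (real i - 1/2) powr (\<alpha> - 1) * cmod (a i))"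
    unfolding midpoint_mean_def norm_mult norm_of_real using assms
    by (intro mult_mono order_trans[OF norm_sum] sum_mono sum_nonneg)
      (auto simp: norm_mult)
  also have "(\<Sum>i=1..n. \<alpha> * (real i - 1/2) powr (\<alpha> - 1) * cmod (a i)) = \<alpha> * (\<Sum>i=1..n. w i * y i)"
    unfolding sum_distrib_left w_def y_def b
    by (intro sum.cong) (auto simp: mult.assoc simp flip: powr_add)
  finally have "cmod (midpoint_mean \<alpha> a n) powr p
      \<le> (1 / real n powr \<alpha> * (\<alpha> * (\<Sum>i=1..n. w i * y i))) powr p"
    using assms by (intro powr_mono2) auto
  also have "\<dots> = \<alpha> powr p * real n powr (- \<alpha> * p) * (\<Sum>i=1..n. w i * y i) powr p"
    using assms by (simp add: powr_mult powr_divide powr_powr powr_minus_divide sum_nonneg w_def y_def)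
  also have "(\<Sum>i=1..n. w i * y i) powr p
      \<le> (\<Sum>i=1..n. w i) powr (p - 1) * (\<Sum>i=1..n. w i * y i powr p)"
    using assms by (intro powr_sum_mult_le) (auto simp: w_def y_def)
  also have "(\<Sum>i=1..n. w i * y i powr p) = S"
    unfolding S_def w_def y_def using assms
    by (intro sum.cong) (auto simp: powr_mult powr_powr powr_diff)
  also have "(\<Sum>i=1..n. w i) powr (p - 1) \<le> (real n powr b / b) powr (p - 1)"
    unfolding w_def using assms
    by (intro powr_mono2 sum_midpoint_powr_le sum_nonneg) auto
  also have "\<alpha> powr p * real n powr (- \<alpha> * p) * ((real n powr b / b) powr (p - 1) * S)
      = \<alpha> powr p / b powr (p - 1) * (real n powr (- \<alpha> * p + b * (p - 1)) * S)"
    using assms(4) unfolding powr_add by (simp add: powr_divide powr_powr)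
  also have "- \<alpha> * p + b * (p - 1) = - b - 1"
    using assms(1) unfolding b by (simp add: field_simps)
  finally show ?thesis
    using S by (simp add: S_def mult_left_mono mult_right_mono)
qed

text \<open>Truncating both sides at the same \<open>N\<close> keeps the interchange of summations
  finite.\<close>

lemma sum_cmod_midpoint_mean_powr_le:
  fixes p \<alpha> :: real and a :: "nat \<Rightarrow> complex"
  assumes "p > 1" "1 \<le> \<alpha>" "\<alpha> \<le> 1 + 1 / p"
  shows "(\<Sum>n=1..N. cmod (midpoint_mean \<alpha> a n) powr p)
    \<le> (\<alpha> * p / (\<alpha> * p - 1)) powr p * (\<Sum>n=1..N. cmod (a n) powr p)"
proof -
  define b where "b = \<alpha> - 1 / p"
  have "1 / p < 1" using assms by simp
  then have b: "0 < b" "b \<le> 1" unfolding b_def using assms by linarith+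
  define K where "K = \<alpha> powr p / b powr (p - 1)"
  define c where "c i = (real i - 1/2) powr b * cmod (a i) powr p" for i :: nat
  have "(\<Sum>n=1..N. cmod (midpoint_mean \<alpha> a n) powr p)
      \<le> (\<Sum>n=1..N. K * (real n powr (- b - 1) * (\<Sum>i=1..n. c i)))"
    unfolding K_def c_def using assms b b_def
    by (intro sum_mono cmod_midpoint_mean_powr_le) auto
  also have "\<dots> = K * (\<Sum>n=1..N. \<Sum>i=1..n. real n powr (- b - 1) * c i)"
    by (simp add: sum_distrib_left)
  also have "(\<Sum>n=1..N. \<Sum>i=1..n. real n powr (- b - 1) * c i)
      = (\<Sum>i=1..N. c i * (\<Sum>n=i..N. real n powr (- b - 1)))"
    unfolding sum_distrib_left sum.Sigma[OF finite_atLeastAtMost ballI[OF finite_atLeastAtMost]]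
    by (rule sum.reindex_bij_witness[of _ "\<lambda>(i, n). (n, i)" "\<lambda>(n, i). (i, n)"]) auto
  also have "K * \<dots> \<le> K * (\<Sum>i=1..N. cmod (a i) powr p / b)"
  proof (intro mult_left_mono sum_mono)
    fix i assume i: "i \<in> {1..N}"
    have "c i * (\<Sum>n=i..N. real n powr (- b - 1)) \<le> c i * ((real i - 1/2) powr (- b) / b)"
      using i b by (intro mult_left_mono sum_powr_le_midpoint) (auto simp: c_def)
    also have "\<dots> = cmod (a i) powr p / b"
      using i by (auto simp: c_def powr_minus field_simps)
    finally show "c i * (\<Sum>n=i..N. real n powr (- b - 1)) \<le> cmod (a i) powr p / b" .
  qed (simp add: K_def)
  \<comment> \<open>The tail sum contributes the last factor \<open>1 / b\<close>, completing
    \<open>b powr (p - 1)\<close> in \<open>K\<close> to \<open>b powr p\<close>.\<close>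
  also have "\<dots> = (\<alpha> / b) powr p * (\<Sum>n=1..N. cmod (a n) powr p)"
    using assms b by (simp add: K_def powr_divide powr_diff flip: sum_divide_distrib)
  also have "\<alpha> / b = \<alpha> * p / (\<alpha> * p - 1)"
    using assms b by (simp add: b_def field_simps)
  finally show ?thesis .
qed

theorem corollary4p1:
  fixes p \<alpha> :: real and a :: "nat \<Rightarrow> complex"
  assumes "p > 1" and "1 \<le> \<alpha>" and "\<alpha> \<le> 1 + 1 / p"
    and "in_lp p a"
  shows "in_lp p (midpoint_mean \<alpha> a) \<and>
    (\<Sum>\<^sub>\<infinity>n\<in>{1..}. cmod (midpoint_mean \<alpha> a n) powr p)
      \<le> (\<alpha> * p / (\<alpha> * p - 1)) powr p * (\<Sum>\<^sub>\<infinity>n\<in>{1..}. cmod (a n) powr p)"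
proof -
  let ?B = "(\<alpha> * p / (\<alpha> * p - 1)) powr p * (\<Sum>\<^sub>\<infinity>n\<in>{1..}. cmod (a n) powr p)"
  \<comment> \<open>For nonnegative terms, one bound uniform over finite index sets yields both
    summability and the estimate of the infinite sum.\<close>
  have bound: "(\<Sum>n\<in>F. cmod (midpoint_mean \<alpha> a n) powr p) \<le> ?B"
    if F: "finite F" "F \<subseteq> {1..}" for F
  proof -
    obtain N where N: "F \<subseteq> {..N}"
      using F(1) finite_nat_iff_bounded_le by blast
    have "(\<Sum>n\<in>F. cmod (midpoint_mean \<alpha> a n) powr p)
        \<le> (\<Sum>n=1..N. cmod (midpoint_mean \<alpha> a n) powr p)"
      using F N by (intro sum_mono2) auto
    also have "\<dots> \<le> (\<alpha> * p / (\<alpha> * p - 1)) powr p * (\<Sum>n=1..N. cmod (a n) powr p)"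
      using assms by (intro sum_cmod_midpoint_mean_powr_le)
    also have "\<dots> \<le> ?B"
      using assms(4) by (intro mult_left_mono finite_sum_le_infsum) (auto simp: in_lp_def)
    finally show ?thesis .
  qed
  have "in_lp p (midpoint_mean \<alpha> a)"
    unfolding in_lp_def using bound
    by (intro nonneg_bdd_above_summable_on bdd_aboveI[of _ ?B]) auto
  then show ?thesis
    using bound by (auto simp: in_lp_def intro!: infsum_le_finite_sums)
qed

end
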